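(* For any $x\in\left(0,\frac{\pi}{2}\right]$ and any $t>0$ one has $$\left(\frac{x}{\sin x}\right)^{2t}+\left(\frac{x}{\sinh x}\right)^t>2$$ and $$\left(\frac{\sinh x}{x}\right)^{2t}+\left(\frac{\sin x}{x}\right)^t>2 .$$ *)

theory Defs imports Complex_Main begin

end

theory Submission imports Defs begin

text \<open>
  By the inequality of arithmetic and geometric means, both sums exceed \<open>2\<close> once the products
  \<open>(x / sin x)\<^sup>2 (x / sinh x)\<close> and \<open>(sinh x / x)\<^sup>2 (sin x / x)\<close> exceed \<open>1\<close>.
  The first follows from \<open>sin x sinh x < x\<^sup>2\<close> (differentiate four times) and \<open>sin x < x\<close>,
  the second from the cubic Taylor bounds: with \<open>u = x\<^sup>2 / 6\<close> it reduces to
  \<open>(1 + u)\<^sup>2 (1 - u) > 1\<close>, that is \<open>u + u\<^sup>2 < 1\<close>.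
\<close>

text \<open>Serves to descend chains of derivatives that vanish at \<open>0\<close>. The sign of
  \<open>f'\<close> is required only on \<open>(0, c]\<close>, since the trigonometric derivatives
  are controlled only up to \<open>pi / 2\<close>.\<close>

lemma pos_if_deriv_pos:
  fixes f f' :: "real \<Rightarrow> real"
  assumes deriv: "\<And>y. (f has_real_derivative f' y) (at y)"
    and pos: "\<And>y. 0 < y \<Longrightarrow> y \<le> c \<Longrightarrow> 0 < f' y"
    and "f 0 = 0" and "0 < x" and "x \<le> c"
  shows "0 < f x"
proof -
  have "f 0 < f x"
  proof (rule DERIV_pos_imp_increasing_open[OF \<open>0 < x\<close>])
    show "\<exists>d. DERIV f y :> d \<and> d > 0" if "0 < y" "y < x" for y
      using deriv[of y] pos[of y] that \<open>x \<le> c\<close> by auto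
    show "continuous_on {0..x} f"
      using deriv by (intro continuous_at_imp_continuous_on ballI DERIV_isCont)
  qed
  then show ?thesis using \<open>f 0 = 0\<close> by simp
qed

lemma sin_ge_cubic: "x - x ^ 3 / 6 \<le> sin x" if "0 \<le> x" for x :: real
proof -
  have "sin 0 - (0 - 0 ^ 3 / 6) \<le> sin x - (x - x ^ 3 / 6)"
  proof (rule DERIV_nonneg_imp_nondecreasing[OF that, where f = "\<lambda>x. sin x - (x - x ^ 3 / 6)"], intro exI conjI)
    show "((\<lambda>x. sin x - (x - x ^ 3 / 6)) has_real_derivative cos y - (1 - y\<^sup>2 / 2)) (at y)"
      for y :: real
      by (auto intro!: derivative_eq_intros)
    show "0 \<le> cos y - (1 - y\<^sup>2 / 2)" for y :: real
      \<comment> \<open>Since cos y = 1 - 2 (sin (y/2))^2, the claim is (sin (y/2))^2 \<le>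
        (y/2)^2.\<close>
      using abs_le_square_iff[THEN iffD1, OF abs_sin_x_le_abs_x[of "y / 2"]] cos_double_sin[of "y / 2"]
      by (simp add: power_divide)
  qed
  then show ?thesis by simp
qed

lemma sinh_gt_self: "x < sinh x" if "0 < x" for x :: real
proof -
  have "0 < sinh x - x"
  proof (rule pos_if_deriv_pos[where f = "\<lambda>x. sinh x - x"
        and f' = "\<lambda>y. cosh y - 1" and c = x])
    show "((\<lambda>x. sinh x - x) has_real_derivative cosh y - 1) (at y)" for y :: real
      by (auto intro!: derivative_eq_intros)
    show "0 < cosh y - 1" if "0 < y" for y :: real
      using cosh_real_strict_mono[of 0 y] that by simp
  qed (use that in auto)
  then show ?thesis by simp
qed

text \<open>Two differentiations reduce the bound to \<open>sinh y - y > 0\<close>.\<close>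

lemma sinh_gt_cubic: "x + x ^ 3 / 6 < sinh x" if "0 < x" for x :: real
proof -
  have "0 < sinh x - (x + x ^ 3 / 6)"
  proof (rule pos_if_deriv_pos[where f = "\<lambda>x. sinh x - (x + x ^ 3 / 6)"
        and f' = "\<lambda>y. cosh y - (1 + y\<^sup>2 / 2)" and c = x])
    show "((\<lambda>x. sinh x - (x + x ^ 3 / 6)) has_real_derivative cosh y - (1 + y\<^sup>2 / 2)) (at y)"
      for y :: real
      by (auto intro!: derivative_eq_intros)
    show "0 < cosh y - (1 + y\<^sup>2 / 2)" if "0 < y" for y :: real
    proof (rule pos_if_deriv_pos[where f = "\<lambda>y. cosh y - (1 + y\<^sup>2 / 2)"
        and f' = "\<lambda>y. sinh y - y" and c = y])
      show "((\<lambda>y. cosh y - (1 + y\<^sup>2 / 2)) has_real_derivative sinh z - z) (at z)" for z :: real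
        by (auto intro!: derivative_eq_intros)
    qed (use that sinh_gt_self in auto)
  qed (use that in auto)
  then show ?thesis by simp
qed

lemma sin_times_sinh_less_square:
  fixes x :: real
  assumes "0 < x" and "x \<le> pi / 2"
  shows "sin x * sinh x < x\<^sup>2"
proof -
  \<comment> \<open>For f = x^2 - sin x sinh x, \<open>d3\<close> and \<open>d2\<close> treat f'''/2
    and f''/2, and \<open>d1\<close> treats f'. The chain starts from f'''' = 4 sin x sinh x >
    0.\<close>
  have d3: "0 < sin y * cosh y - cos y * sinh y" if "0 < y" "y \<le> pi / 2" for y :: real
  proof (rule pos_if_deriv_pos[where f = "\<lambda>y. sin y * cosh y - cos y * sinh y"
        and f' = "\<lambda>y. 2 * (sin y * sinh y)" and c = "pi / 2"])
    show "((\<lambda>y. sin y * cosh y - cos y * sinh y) has_real_derivative 2 * (sin z * sinh z)) (at z)"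
      for z :: real
      by (auto intro!: derivative_eq_intros)
    show "0 < 2 * (sin z * sinh z)" if "0 < z" "z \<le> pi / 2" for z :: real
      using that sin_gt_zero[of z] pi_gt_zero by simp
  qed (use that in auto)
  have d2: "0 < 1 - cos y * cosh y" if "0 < y" "y \<le> pi / 2" for y :: real
  proof (rule pos_if_deriv_pos[where f = "\<lambda>y. 1 - cos y * cosh y"
        and f' = "\<lambda>y. sin y * cosh y - cos y * sinh y" and c = "pi / 2"])
    show "((\<lambda>y. 1 - cos y * cosh y) has_real_derivative sin z * cosh z - cos z * sinh z) (at z)"
      for z :: real
      by (auto intro!: derivative_eq_intros)
  qed (use that d3 in auto)
  have d1: "0 < 2 * y - (cos y * sinh y + sin y * cosh y)" if "0 < y" "y \<le> pi / 2" for y :: real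
  proof (rule pos_if_deriv_pos[where f = "\<lambda>y. 2 * y - (cos y * sinh y + sin y * cosh y)"
        and f' = "\<lambda>y. 2 * (1 - cos y * cosh y)" and c = "pi / 2"])
    show "((\<lambda>y. 2 * y - (cos y * sinh y + sin y * cosh y))
        has_real_derivative 2 * (1 - cos z * cosh z)) (at z)" for z :: real
      by (auto intro!: derivative_eq_intros)
  qed (use that d2 in auto)
  have "0 < x\<^sup>2 - sin x * sinh x"
  proof (rule pos_if_deriv_pos[where f = "\<lambda>x. x\<^sup>2 - sin x * sinh x"
        and f' = "\<lambda>y. 2 * y - (cos y * sinh y + sin y * cosh y)"
        and c = "pi / 2"])
    show "((\<lambda>x. x\<^sup>2 - sin x * sinh x)
        has_real_derivative 2 * z - (cos z * sinh z + sin z * cosh z)) (at z)" for z :: real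
      by (auto intro!: derivative_eq_intros)
  qed (use assms d1 in auto)
  then show ?thesis by simp
qed

text \<open>Evaluating the cubic bound for \<open>sin\<close> at \<open>pi / 6\<close>, where \<open>sin\<close> equals \<open>1 / 2\<close>,
  improves \<open>pi < 4\<close> enough for \<open>u + u\<^sup>2 < 1\<close>.\<close>

lemma pi_less_18_5: "pi < 18 / 5"
proof -
  define y where "y = pi / 6"
  have y: "0 < y" "y < 2 / 3"
    using pi_less_4 by (auto simp: y_def)
  have "y\<^sup>2 \<le> (2 / 3)\<^sup>2"
    using y by (intro power_mono) auto
  then have "y * y\<^sup>2 \<le> y * (4 / 9)"
    using y by (intro mult_left_mono) (auto simp: power2_eq_square)
  moreover have "y - y ^ 3 / 6 \<le> 1 / 2"
    using sin_ge_cubic[of y] y sin_30 by (simp add: y_def)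
  \<comment> \<open>Replacing y^3 by 4y/9 gives (25/27) y \<le> 1/2, so y \<le> 27/50.\<close>
  ultimately have "y < 3 / 5"
    by (simp add: power3_eq_cube power2_eq_square)
  then show ?thesis by (simp add: y_def)
qed

lemma cube_less_sinh_square_times_sin:
  fixes x :: real
  assumes "0 < x" and "x \<le> pi / 2"
  shows "x ^ 3 < (sinh x)\<^sup>2 * sin x"
proof -
  define u where "u = x\<^sup>2 / 6"
  have cubic: "x ^ 3 / 6 = x * u"
    by (simp add: u_def power2_eq_square power3_eq_cube)
  have "x\<^sup>2 \<le> (9 / 5)\<^sup>2"
    using assms pi_less_18_5 by (intro power_mono) auto
  then have u: "0 < u" "u < 3 / 5"
    using assms by (auto simp: u_def power2_eq_square)
  \<comment> \<open>Hence u + u^2 \<le> (8/5) u < 24/25.\<close>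
  have "u * u \<le> 3 / 5 * u"
    using u by (intro mult_right_mono) auto
  then have "0 < 1 - u - u * u"
    using u by linarith
  then have "0 < u * (1 - u - u * u)"
    using u by simp
  \<comment> \<open>Expanding, (1 + u)^2 (1 - u) = 1 + u (1 - u - u^2).\<close>
  then have "1 < (1 + u)\<^sup>2 * (1 - u)"
    by (simp add: power2_eq_square algebra_simps)
  then have "x ^ 3 * 1 < x ^ 3 * ((1 + u)\<^sup>2 * (1 - u))"
    using assms by (intro mult_strict_left_mono) auto
  also have "\<dots> = (x + x ^ 3 / 6)\<^sup>2 * (x - x ^ 3 / 6)"
    unfolding cubic by (simp add: power2_eq_square power3_eq_cube algebra_simps)
  also have "\<dots> < (sinh x)\<^sup>2 * sin x"
  proof (rule mult_less_le_imp_less)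
    show "(x + x ^ 3 / 6)\<^sup>2 < (sinh x)\<^sup>2"
      using assms sinh_gt_cubic[of x] by (intro power_strict_mono) auto
    show "0 < x - x ^ 3 / 6"
      unfolding cubic using u assms by simp
  qed (use assms sin_ge_cubic[of x] in auto)
  finally show ?thesis by simp
qed

text \<open>The exponents are matched so that the two terms have product (a^2 b)^t, which exceeds 1
  for every t > 0.\<close>

lemma powr_sum_gt_2:
  fixes a b t :: real
  assumes "0 < a" and "0 < b" and "1 < a\<^sup>2 * b" and "0 < t"
  shows "2 < a powr (2 * t) + b powr t"
proof -
  define p q where "p = a powr (2 * t)" and "q = b powr t"
  have "p * q = (a\<^sup>2 * b) powr t"
    using assms by (simp add: p_def q_def powr_mult powr_powr flip: powr_numeral)
  also have "\<dots> > 1"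
    using assms by (intro gr_one_powr) auto
  finally have "1 < sqrt (p * q)"
    by simp
  also have "\<dots> \<le> (p + q) / 2"
    by (intro arith_geo_mean_sqrt) (simp_all add: p_def q_def)
  finally show ?thesis
    by (simp add: p_def q_def)
qed

theorem theorem1:
  fixes x t :: real
  assumes "x \<in> {0<..pi / 2}" and "t > 0"
  shows "(x / sin x) powr (2 * t) + (x / sinh x) powr t > 2 \<and>
         (sinh x / x) powr (2 * t) + (sin x / x) powr t > 2"
proof -
  have x: "0 < x" "x \<le> pi / 2"
    using assms by auto
  have sin: "0 < sin x"
    using x sin_gt_zero[of x] pi_gt_zero by simp
  have sinh: "0 < sinh x"
    using x by simp
  \<comment> \<open>The first product is x^3 / ((sin x)^2 sinh x). One factor sin x is paired with
    sinh x, which supplies the strictness; the other is at most x.\<close>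
  have "(sin x)\<^sup>2 * sinh x = sin x * (sin x * sinh x)"
    by (simp add: power2_eq_square)
  also have "\<dots> < x * x\<^sup>2"
    using x sin sinh sin_times_sinh_less_square[OF x] sin_x_le_x[of x]
    by (intro mult_le_less_imp_less) auto
  finally have "1 < (x / sin x)\<^sup>2 * (x / sinh x)"
    using sin sinh by (simp add: power2_eq_square mult_ac)
  moreover have "1 < (sinh x / x)\<^sup>2 * (sin x / x)"
    using cube_less_sinh_square_times_sin[OF x] x
    by (simp add: power2_eq_square power3_eq_cube mult_ac)
  ultimately show ?thesis
    using x sin sinh \<open>t > 0\<close> by (intro conjI powr_sum_gt_2) auto
qed

end
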